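(* Let $S$ be a monoid and let $a,b,d\in S$ with $ad=da$. If $a$ and $b$ are both invertible along $d$ (i.e. $a^{\parallel d}$ and $b^{\parallel d}$ exist), then: (i) $(ab)^{\parallel d}$ exists and $(ab)^{\parallel d}=b^{\parallel d}a^{\parallel d}$; (ii) $(ba)^{\parallel d}$ exists and $(ba)^{\parallel d}=a^{\parallel d}b^{\parallel d}$.
   Context: In a monoid $S$, write $x\leq_{\mathcal H}d$ if $Sx\subseteq Sd$ and $xS\subseteq dS$. An element $a\in S$ is invertible along $d\in S$ if there exists $b\in S$ such that $bad=d=dab$ and $b\leq_{\mathcal H}d$. Such $b$ is unique if it exists; it is called the inverse of $a$ along $d$ and denoted $a^{\parallel d}$. *)

theory Defs
  imports Main
begin

definition le_H :: "'a::monoid_mult \<Rightarrow> 'a \<Rightarrow> bool"  (infix "\<le>\<^sub>H" 50)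
  where "x \<le>\<^sub>H d \<longleftrightarrow> range (\<lambda>s. s * x) \<subseteq> range (\<lambda>s. s * d)
                    \<and> range (\<lambda>s. x * s) \<subseteq> range (\<lambda>s. d * s)"

definition is_inverse_along :: "'a::monoid_mult \<Rightarrow> 'a \<Rightarrow> 'a \<Rightarrow> bool"
  where "is_inverse_along a d b \<longleftrightarrow> b * a * d = d \<and> d * a * b = d \<and> b \<le>\<^sub>H d"

definition invertible_along :: "'a::monoid_mult \<Rightarrow> 'a \<Rightarrow> bool"
  where "invertible_along a d \<longleftrightarrow> (\<exists>b. is_inverse_along a d b)"

text \<open>The inverse \<open>a\<^sup>\<parallel>\<^sup>d\<close>; meaningful only when \<open>invertible_along a d\<close> holds, in which
  case it is well defined by \<open>is_inverse_along_unique\<close>.\<close>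

definition inverse_along :: "'a::monoid_mult \<Rightarrow> 'a \<Rightarrow> 'a"
  where "inverse_along a d = (THE b. is_inverse_along a d b)"

lemma is_inverse_along_unique:
  assumes "is_inverse_along a d b" and "is_inverse_along a d c"
  shows "b = c"
proof -
  have "1 * b \<in> range (\<lambda>s. s * d)" and "c * 1 \<in> range (\<lambda>s. d * s)"
    using assms unfolding is_inverse_along_def le_H_def by blast+
  then obtain x y where x: "b = x * d" and y: "c = d * y" by auto
  have "b * a * c = x * (d * a * c)" by (simp add: x mult.assoc)
  also have "\<dots> = b" using assms(2) by (simp add: is_inverse_along_def x)
  finally have "b * a * c = b" .
  moreover have "b * a * c = (b * a * d) * y" by (simp add: y mult.assoc)
  moreover have "\<dots> = c" using assms(1) by (simp add: is_inverse_along_def y)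
  ultimately show ?thesis by simp
qed

end

(* If d commutes with a, then a commutes with its inverse a' along d. Hence d a' a = d and
   a a' d = d, so in b' a' a b d and d b a a' b' the middle factors cancel against the factor d
   contained in b'. *)
theory Submission
  imports Defs
begin

text \<open>Multiplier \<open>1\<close> puts \<open>x\<close> in its own principal ideals, so each
  inclusion reduces to membership of the generator; the factors obtained this way drive all later
  cancellations.\<close>

lemma le_H_iff: "x \<le>\<^sub>H d \<longleftrightarrow> (\<exists>s. x = s * d) \<and> (\<exists>t. x = d * t)"
proof
  assume "x \<le>\<^sub>H d"
  then have "1 * x \<in> range (\<lambda>s. s * d)" and "x * 1 \<in> range (\<lambda>s. d * s)"
    unfolding le_H_def by blast+
  then show "(\<exists>s. x = s * d) \<and> (\<exists>t. x = d * t)" by auto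
next
  assume "(\<exists>s. x = s * d) \<and> (\<exists>t. x = d * t)"
  then obtain s t where "x = s * d" and "x = d * t" by blast
  then have "r * x = (r * s) * d" and "x * r = d * (t * r)" for r
    by (simp add: mult.assoc, metis mult.assoc)
  then show "x \<le>\<^sub>H d" unfolding le_H_def by blast
qed

lemma is_inverse_alongE:
  assumes "is_inverse_along a d b"
  obtains s t where "b * a * d = d" and "d * a * b = d" and "b = s * d" and "b = d * t"
  using assms unfolding is_inverse_along_def le_H_iff by blast

text \<open>Both products equal \<open>c * a * a * c\<close>: each contains a \<open>d\<close>
  hidden in \<open>c\<close>, and moving \<open>a\<close> past that \<open>d\<close> makes room to
  expand it.\<close>

lemma is_inverse_along_commute:
  assumes ad: "a * d = d * a" and "is_inverse_along a d c"
  shows "a * c = c * a"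
proof -
  obtain s t where l: "c * a * d = d" and r: "d * a * c = d" and s: "c = s * d" and t: "c = d * t"
    using assms(2) by (rule is_inverse_alongE)
  have "a * c = d * a * t" by (simp add: t ad flip: mult.assoc)
  \<comment> \<open>Here \<open>d\<close> is expanded to \<open>c * a * d\<close> on its left; the
    computation of \<open>c * a\<close> below expands it to \<open>d * a * c\<close> on its
    right.\<close>
  also have "\<dots> = c * a * (d * a) * t" using l by (simp flip: mult.assoc)
  also have "\<dots> = c * a * a * c" by (simp add: t mult.assoc flip: ad)
  finally have 1: "a * c = c * a * a * c" .
  have "c * a = s * a * d" by (simp add: s ad mult.assoc)
  also have "\<dots> = s * (a * d) * a * c" using r by (simp add: mult.assoc)
  also have "\<dots> = c * a * a * c" by (simp only: s ad mult.assoc)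
  finally show ?thesis using 1 by simp
qed

text \<open>Of the four cancellation equations, the two with \<open>a\<close> and \<open>a'\<close>
  adjacent use absorption into \<open>b'\<close>; the two with \<open>b\<close> and
  \<open>b'\<close> adjacent move \<open>a\<close> past \<open>d\<close> to reach
  \<open>d * b * b'\<close> or \<open>b' * b * d\<close>.\<close>

lemma is_inverse_along_mult:
  assumes ad: "a * d = d * a"
    and a: "is_inverse_along a d a'" and b: "is_inverse_along b d b'"
  shows "is_inverse_along (a * b) d (b' * a')"
    and "is_inverse_along (b * a) d (a' * b')"
proof -
  obtain x y where la: "a' * a * d = d" and ra: "d * a * a' = d" and x: "a' = x * d" and y: "a' = d * y"
    using a by (rule is_inverse_alongE)
  obtain u v where lb: "b' * b * d = d" and rb: "d * b * b' = d" and u: "b' = u * d" and v: "b' = d * v"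
    using b by (rule is_inverse_alongE)
  have com: "a * a' = a' * a" using ad a by (rule is_inverse_along_commute)
  \<comment> \<open>Commutation of \<open>a\<close> and \<open>a'\<close> turns
    \<open>a' * a\<close> into the order that \<open>d\<close>, the right factor of
    \<open>b'\<close>, absorbs.\<close>
  have "b' * (a' * a) = u * (d * a * a')" by (simp only: u com mult.assoc)
  then have b'_absorb: "b' * (a' * a) = b'" by (simp add: ra u)
  have "(a * a') * b' = (a' * a * d) * v" by (simp only: v com mult.assoc)
  then have absorb_b': "(a * a') * b' = b'" by (simp add: la v)

  have "b' * a' * (a * b) * d = b' * (a' * a) * b * d" by (simp only: mult.assoc)
  then have l1: "b' * a' * (a * b) * d = d" by (simp add: b'_absorb lb)
  have "d * (a * b) * (b' * a') = a * (d * b * b') * a'"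
    using ad by (simp flip: mult.assoc)
  then have r1: "d * (a * b) * (b' * a') = d" by (simp add: rb ad ra)
  \<comment> \<open>The last factor supplies a right factor \<open>d\<close>, the first one a left
    factor \<open>d\<close>.\<close>
  have "b' * a' = (b' * x) * d" and "b' * a' = d * (v * a')"
    by (simp add: x mult.assoc, simp add: v mult.assoc)
  then show "is_inverse_along (a * b) d (b' * a')"
    using l1 r1 unfolding is_inverse_along_def le_H_iff by blast

  have "a' * b' * (b * a) * d = a' * (b' * b * d) * a" by (simp only: ad mult.assoc)
  \<comment> \<open>After \<open>b' * b * d\<close> collapses to \<open>d\<close>, the displaced
    \<open>a\<close> moves back across it.\<close>
  also have "\<dots> = a' * a * d" by (simp add: lb) (simp only: ad mult.assoc)
  finally have l2: "a' * b' * (b * a) * d = d" by (simp add: la)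
  have "d * (b * a) * (a' * b') = d * b * ((a * a') * b')" by (simp only: mult.assoc)
  then have r2: "d * (b * a) * (a' * b') = d" by (simp add: absorb_b' rb)
  have "a' * b' = (a' * u) * d" and "a' * b' = d * (y * b')"
    by (simp add: u mult.assoc, simp add: y mult.assoc)
  then show "is_inverse_along (b * a) d (a' * b')"
    using l2 r2 unfolding is_inverse_along_def le_H_iff by blast
qed

lemma inverse_along_eqI: "is_inverse_along a d b \<Longrightarrow> inverse_along a d = b"
  unfolding inverse_along_def by (blast intro: is_inverse_along_unique)

theorem theorem2p14:
  fixes a b d :: "'a::monoid_mult"
  assumes "a * d = d * a"
    and "invertible_along a d"
    and "invertible_along b d"
  shows "(invertible_along (a * b) d \<and>
            inverse_along (a * b) d = inverse_along b d * inverse_along a d) \<and>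
         (invertible_along (b * a) d \<and>
            inverse_along (b * a) d = inverse_along a d * inverse_along b d)"
proof -
  obtain a' b' where a: "is_inverse_along a d a'" and b: "is_inverse_along b d b'"
    using assms(2,3) unfolding invertible_along_def by blast
  note ab = is_inverse_along_mult[OF assms(1) a b]
  from ab have "invertible_along (a * b) d" "invertible_along (b * a) d"
    unfolding invertible_along_def by blast+
  then show ?thesis
    by (simp add: inverse_along_eqI[OF a] inverse_along_eqI[OF b]
        inverse_along_eqI[OF ab(1)] inverse_along_eqI[OF ab(2)])
qed

end
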